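(* For every $n\ge 7$, every Gallai-3-coloring of $K_n$ contains a $2$-connected subgraph of order $n$ using at most two colors.
   Context: A Gallai-3-coloring of $K_n$ is an edge-coloring of $K_n$ with three colors, all three of which appear, containing no rainbow triangle (a triangle whose three edges have pairwise different colors). The order of a graph is its number of vertices. A subgraph uses at most two colors if its edges receive at most two colors in total. *)

theory Defs
  imports "Graph_Theory.Kuratowski"
begin

text \<open>
  As in the Graph-Theory library, an undirected simple graph is a symmetric digraph (locale
  \<open>graph\<close>). Its undirected edges are the vertex sets of its pairs of opposite arcs. An
  edge-coloring is a function on two-element vertex sets, so both orientations of an edge
  necessarily have the same color.
\<close>

definition edge_set :: "('a, 'b) pre_digraph \<Rightarrow> 'a set set" where
  "edge_set G = {{u, v} | u v. u \<rightarrow>\<^bsub>G\<^esub> v}"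

definition colors_used :: "('a set \<Rightarrow> 'c) \<Rightarrow> ('a, 'b) pre_digraph \<Rightarrow> 'c set" where
  "colors_used c G = c ` edge_set G"

definition rainbow_triangle ::
  "('a, 'b) pre_digraph \<Rightarrow> ('a set \<Rightarrow> 'c) \<Rightarrow> 'a \<Rightarrow> 'a \<Rightarrow> 'a \<Rightarrow> bool" where
  "rainbow_triangle G c u v w \<longleftrightarrow>
     u \<rightarrow>\<^bsub>G\<^esub> v \<and> v \<rightarrow>\<^bsub>G\<^esub> w \<and> u \<rightarrow>\<^bsub>G\<^esub> w \<and>
     c {u, v} \<noteq> c {v, w} \<and> c {v, w} \<noteq> c {u, w} \<and> c {u, v} \<noteq> c {u, w}"

text \<open>
  The color type is arbitrary; the number of colors is the number of those that appear.
\<close>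

definition gallai_coloring ::
  "nat \<Rightarrow> ('a, 'b) pre_digraph \<Rightarrow> ('a set \<Rightarrow> 'c) \<Rightarrow> bool" where
  "gallai_coloring k G c \<longleftrightarrow>
     card (colors_used c G) = k \<and> (\<nexists>u v w. rainbow_triangle G c u v w)"

text \<open>
  The usual convention: more than \<open>k\<close> vertices, and deleting fewer than \<open>k\<close> vertices never
  disconnects the graph. The first conjunct forces the vertex set to be finite.
\<close>

definition k_connected :: "nat \<Rightarrow> ('a, 'b) pre_digraph \<Rightarrow> bool" where
  "k_connected k G \<longleftrightarrow>
     k < card (verts G) \<and>
     (\<forall>X \<subseteq> verts G. card X < k \<longrightarrow> connected (G \<restriction> (verts G - X)))"

end

theory Submission
  imports Defs
begin

text \<open>
  Delete one color class from \<open>G\<close>. What is left is spanning and uses two colors, so it suffices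
  that for some color it is 2-connected. Suppose that this fails for each of the three colors.

  If deleting color \<open>i\<close> destroys 2-connectivity, some vertex \<open>x\<^sub>i\<close> is such that the remaining
  vertices split into two nonempty parts with only color \<open>i\<close> between them
  (\<open>color_cut_if_not_2_connected\<close>). Two cuts of different colors cannot coexist on the same
  vertex set, since some pair of vertices would be separated by both. So after
  removing both \<open>x\<^sub>i\<close> and \<open>x\<^sub>j\<close>, one of the two cuts must have lost a whole part: one of the
  parts for color \<open>i\<close> was just \<open>{x\<^sub>j}\<close>, or one of the parts for color \<open>j\<close> was just \<open>{x\<^sub>i}\<close>
  (\<open>two_color_cuts\<close>). In the first case write \<open>i \<rightarrow> j\<close>; it says that \<open>x\<^sub>j\<close> sends color \<open>i\<close> to every
  vertex except possibly \<open>x\<^sub>i\<close>.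

  A fourth vertex shows that no color is the target of two arrows, so the three arrows form a
  directed cycle, say \<open>1 \<rightarrow> 2 \<rightarrow> 3 \<rightarrow> 1\<close>. Then \<open>x\<^sub>2x\<^sub>3\<close>, \<open>x\<^sub>3x\<^sub>1\<close>, \<open>x\<^sub>1x\<^sub>2\<close> have colors \<open>1, 2, 3\<close>, and
  \<open>x\<^sub>1x\<^sub>2x\<^sub>3\<close> is a rainbow triangle.
\<close>

definition color_cut :: "('a set \<Rightarrow> 'c) \<Rightarrow> 'c \<Rightarrow> 'a set \<Rightarrow> 'a set \<Rightarrow> bool" where
  "color_cut c i W A \<longleftrightarrow>
     A \<subset> W \<and> A \<noteq> {} \<and> (\<forall>a\<in>A. \<forall>b\<in>W - A. c {a, b} = i)"

text \<open>
  The arrow of the introduction. The edge \<open>xy\<close> is exempt because a cut of \<open>V - {x}\<close> says nothing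
  about edges at \<open>x\<close>.
\<close>

definition near_star :: "('a set \<Rightarrow> 'c) \<Rightarrow> 'a set \<Rightarrow> 'c \<Rightarrow> 'a \<Rightarrow> 'a \<Rightarrow> bool" where
  "near_star c V i x y \<longleftrightarrow> (\<forall>v\<in>V - {x, y}. c {y, v} = i)"

definition delete_color ::
  "('a, 'b) pre_digraph \<Rightarrow> ('a set \<Rightarrow> 'c) \<Rightarrow> 'c \<Rightarrow> ('a, 'b) pre_digraph" where
  "delete_color G c i = G\<lparr>arcs := {e \<in> arcs G. c {tail G e, head G e} \<noteq> i}\<rparr>"

section \<open>Color cuts\<close>

text \<open>
  The four intersections of the parts of both cuts lie in \<open>W\<close>; opposite ones cannot both be
  nonempty, because an edge between them would have both colors. Hence one of the four parts is
  disjoint from both parts of the other cut.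
\<close>

lemma color_cuts_same_color:
  assumes A: "color_cut c i W A" and B: "color_cut c j W B"
  shows "i = j"
proof (rule ccontr)
  assume ne: "i \<noteq> j"
  have crossing: False if "a \<in> A \<inter> B" "b \<in> W - A - B" for a b
  proof -
    have "b \<in> W - A" "b \<in> W - B" "a \<in> A" "a \<in> B" using that by auto
    then have "c {a, b} = i" "c {a, b} = j"
      using A B unfolding color_cut_def by blast+
    then show False using ne by simp
  qed
  have crossing': False if a: "a \<in> A - B" and b: "b \<in> B - A" for a b
  proof -
    have "b \<in> W - A" "a \<in> W - B" using A B a b unfolding color_cut_def by auto
    then have "c {a, b} = i" "c {b, a} = j"
      using A B a b unfolding color_cut_def by blast+
    then show False using ne by (simp add: insert_commute)
  qed
  have "A \<inter> B = {} \<or> W - A - B = {}" "A - B = {} \<or> B - A = {}"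
    using crossing crossing' by (metis equals0I)+
  moreover have "A \<subset> W" "B \<subset> W" "A \<noteq> {}" "B \<noteq> {}"
    using A B unfolding color_cut_def by auto
  ultimately show False by auto
qed

lemma color_cut_restrict:
  assumes "color_cut c i (V - {x}) A" "A \<noteq> {y}" "V - {x} - A \<noteq> {y}"
  shows "color_cut c i (V - {x, y}) (A - {y})"
proof -
  have "A - {y} \<noteq> {}" "V - {x} - A - {y} \<noteq> {}"
    using assms unfolding color_cut_def by auto
  then show ?thesis
    using assms unfolding color_cut_def by blast
qed

lemma color_cut_singleton_near_star:
  assumes "color_cut c i (V - {x}) A" "A = {y} \<or> V - {x} - A = {y}"
  shows "near_star c V i x y"
  unfolding near_star_def
proof
  fix v assume v: "v \<in> V - {x, y}"
  from assms(2) show "c {y, v} = i"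
  proof
    assume "A = {y}"
    then show ?thesis using assms(1) v unfolding color_cut_def by auto
  next
    assume B: "V - {x} - A = {y}"
    then have "v \<in> A" "y \<in> V - {x} - A" using v by auto
    then have "c {v, y} = i" using assms(1) unfolding color_cut_def by blast
    then show ?thesis by (simp add: insert_commute)
  qed
qed

text \<open>
  Both cuts restrict to \<open>V - {x, y}\<close>. As they cannot both survive there, one of them has a part
  that consists of the removed vertex only.
\<close>

lemma two_color_cuts:
  assumes A: "color_cut c i (V - {x}) A" and B: "color_cut c j (V - {y}) B" and "i \<noteq> j"
  shows "x \<noteq> y \<and> (near_star c V i x y \<or> near_star c V j y x)"
proof
  show "x \<noteq> y"
    using color_cuts_same_color[of c i "V - {x}" A j B] A B \<open>i \<noteq> j\<close> by auto
  show "near_star c V i x y \<or> near_star c V j y x"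
  proof (rule ccontr)
    assume neg: "\<not> ?thesis"
    have "color_cut c i (V - {x, y}) (A - {y})"
      by (rule color_cut_restrict[OF A]) (use color_cut_singleton_near_star[OF A] neg in auto)
    moreover have "color_cut c j (V - {x, y}) (B - {x})"
      unfolding insert_commute[of x y "{}"]
      by (rule color_cut_restrict[OF B]) (use color_cut_singleton_near_star[OF B] neg in auto)
    ultimately have "i = j" by (rule color_cuts_same_color)
    with \<open>i \<noteq> j\<close> show False ..
  qed
qed

lemma near_star_unique_color:
  assumes "near_star c V i x z" "near_star c V j y z" "v \<in> V - {x, y, z}"
  shows "i = j"
proof -
  have "c {z, v} = i" "c {z, v} = j"
    using assms unfolding near_star_def by blast+
  then show ?thesis by simp
qed

lemma near_star_cycle_rainbow:
  assumes "near_star c V i x y" "near_star c V j y z" "near_star c V k z x"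
    and "x \<in> V" "y \<in> V" "z \<in> V" "x \<noteq> y" "y \<noteq> z" "x \<noteq> z"
  shows "c {y, z} = i \<and> c {x, z} = j \<and> c {x, y} = k"
proof -
  have "c {y, z} = i" "c {z, x} = j" "c {x, y} = k"
    using assms unfolding near_star_def by blast+
  then show ?thesis by (simp add: insert_commute)
qed

text \<open>
  The arrows between the three colors form a tournament in which no color is entered twice, and
  such a tournament is a directed cycle. The fourth vertex serves to compare two arrows
  entering the same color.
\<close>

lemma three_color_cuts_rainbow:
  assumes cuts: "color_cut c i (V - {x}) A" "color_cut c j (V - {y}) B"
      "color_cut c k (V - {z}) C"
    and ne: "i \<noteq> j" "j \<noteq> k" "i \<noteq> k"
    and V: "x \<in> V" "y \<in> V" "z \<in> V" "4 \<le> card V"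
  shows "distinct [x, y, z] \<and> distinct [c {x, y}, c {y, z}, c {x, z}]"
proof -
  have xy: "x \<noteq> y" "near_star c V i x y \<or> near_star c V j y x"
    using two_color_cuts[OF cuts(1) cuts(2) ne(1)] by auto
  have yz: "y \<noteq> z" "near_star c V j y z \<or> near_star c V k z y"
    using two_color_cuts[OF cuts(2) cuts(3) ne(2)] by auto
  have xz: "x \<noteq> z" "near_star c V i x z \<or> near_star c V k z x"
    using two_color_cuts[OF cuts(1) cuts(3) ne(3)] by auto
  have "\<not> V \<subseteq> {x, y, z}"
  proof
    assume "V \<subseteq> {x, y, z}"
    then have "card V \<le> card {x, y, z}" by (intro card_mono) auto
    also have "\<dots> \<le> 3" by (auto simp: card_insert_if)
    finally show False using V(4) by simp
  qed
  then obtain v where v: "v \<in> V" "v \<notin> {x, y, z}" by blast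
  have once: "\<not> (near_star c V k z y \<and> near_star c V i x y)"
    "\<not> (near_star c V j y x \<and> near_star c V k z x)"
    "\<not> (near_star c V j y z \<and> near_star c V i x z)"
    using near_star_unique_color[of c V k z y i x v] near_star_unique_color[of c V j y x k z v]
      near_star_unique_color[of c V j y z i x v] v ne by auto
  then consider
      "near_star c V i x y" "near_star c V j y z" "near_star c V k z x"
    | "near_star c V j y x" "near_star c V i x z" "near_star c V k z y"
    using xy(2) yz(2) xz(2) by blast
  then show ?thesis
  proof cases
    case 1
    then show ?thesis
      using near_star_cycle_rainbow[OF 1 V(1-3)] xy(1) yz(1) xz(1) ne by auto
  next
    case 2
    then show ?thesis
      using near_star_cycle_rainbow[OF 2 V(2,1,3)] xy(1) yz(1) xz(1) ne
      by (auto simp: insert_commute)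
  qed
qed

section \<open>Separations of graphs that are not 2-connected\<close>

text \<open>
  The vertices reachable from \<open>u\<close> form a separating part if some vertex is not reachable from \<open>u\<close>.
\<close>

lemma not_connected_separation:
  assumes ne: "verts K \<noteq> {}" and nc: "\<not> connected K"
  shows "\<exists>A. A \<subset> verts K \<and> A \<noteq> {} \<and> (\<forall>a\<in>A. \<forall>b\<in>verts K - A. \<not> a \<rightarrow>\<^bsub>K\<^esub> b)"
proof -
  let ?S = "with_proj (mk_symmetric K)"
  have verts: "verts ?S = verts K"
    by (simp add: mk_symmetric_def)
  obtain u v where uv: "u \<in> verts K" "v \<in> verts K" "\<not> u \<rightarrow>\<^sup>*\<^bsub>?S\<^esub> v"
    using ne nc unfolding connected_def strongly_connected_def verts by blast
  let ?A = "{w. u \<rightarrow>\<^sup>*\<^bsub>?S\<^esub> w}"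
  have "u \<in> ?A" using uv(1) verts unfolding reachable_def by auto
  moreover have "?A \<subseteq> verts K"
    using verts by (metis mem_Collect_eq reachable_in_vertsE subsetI)
  moreover have "b \<in> ?A" if "a \<in> ?A" "b \<in> verts K" "a \<rightarrow>\<^bsub>K\<^esub> b" for a b
  proof -
    have "a \<rightarrow>\<^bsub>?S\<^esub> b" using that(3) by (auto simp: mk_symmetric_def arcs_ends_conv)
    then show ?thesis
      using that(1,2) verts rtrancl_on_into_rtrancl_on[of u a "verts ?S" "arcs_ends ?S" b]
      unfolding reachable_def by simp
  qed
  moreover have "v \<notin> ?A" using uv(3) by simp
  ultimately show ?thesis using uv(2) by (intro exI[of _ ?A]) blast
qed

text \<open>
  The definition of 2-connectivity also forbids that the whole graph is disconnected. With at
  least three vertices this reduces to a separation that omits one vertex: omit a vertex of a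
  part that has another one.
\<close>

lemma not_2_connected_separation:
  assumes card: "3 \<le> card (verts H)" and nc: "\<not> k_connected 2 H"
  shows "\<exists>x\<in>verts H. \<exists>A. A \<subset> verts H - {x} \<and> A \<noteq> {} \<and>
           (\<forall>a\<in>A. \<forall>b\<in>verts H - {x} - A. \<not> a \<rightarrow>\<^bsub>H\<^esub> b)"
proof -
  let ?V = "verts H"
  have fin: "finite ?V" using card by (intro card_ge_0_finite) simp
  obtain X where X: "X \<subseteq> ?V" "card X < 2" "\<not> connected (H \<restriction> (?V - X))"
    using card nc unfolding k_connected_def by auto
  have "X \<noteq> ?V" using X(2) card by auto
  then obtain A where A: "A \<subset> ?V - X" "A \<noteq> {}"
      "\<forall>a\<in>A. \<forall>b\<in>?V - X - A. \<not> a \<rightarrow>\<^bsub>H \<restriction> (?V - X)\<^esub> b"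
    using not_connected_separation[OF _ X(3)] X(1) by auto
  have sep: "\<not> a \<rightarrow>\<^bsub>H\<^esub> b" if "a \<in> A" "b \<in> ?V - X - A" for a b
    using A(1,3) that by (force simp: arcs_ends_conv induce_subgraph_def)
  have "finite X" using fin X(1) finite_subset by blast
  have "card X = 0 \<or> card X = 1" using X(2) by linarith
  then show ?thesis
  proof
    assume "card X = 1"
    then obtain x where "X = {x}" by (rule card_1_singletonE)
    then have "A \<subset> ?V - {x}" "\<forall>a\<in>A. \<forall>b\<in>?V - {x} - A. \<not> a \<rightarrow>\<^bsub>H\<^esub> b"
      using A(1) sep by blast+
    then show ?thesis using A(2) X(1) \<open>X = {x}\<close> by blast
  next
    assume "card X = 0"
    then have "X = {}" using \<open>finite X\<close> by simp
    then have AV: "A \<subset> ?V" using A(1) by simp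
    have sep': "\<not> a \<rightarrow>\<^bsub>H\<^esub> b" if "a \<in> A" "b \<in> ?V - A" for a b
      using that sep \<open>X = {}\<close> by simp
    obtain a where a: "a \<in> A" using A(2) by blast
    obtain b where b: "b \<in> ?V" "b \<notin> A" using AV by blast
    have "\<not> ?V \<subseteq> {a, b}"
    proof
      assume "?V \<subseteq> {a, b}"
      then have "card ?V \<le> card {a, b}" by (intro card_mono) auto
      also have "\<dots> \<le> 2" by (auto simp: card_insert_if)
      finally show False using card by simp
    qed
    then obtain x where x: "x \<in> ?V" "x \<noteq> a" "x \<noteq> b" by blast
    have "A - {x} \<subset> ?V - {x}" "A - {x} \<noteq> {}"
      using AV a b x by auto
    moreover have "\<forall>p\<in>A - {x}. \<forall>q\<in>?V - {x} - (A - {x}). \<not> p \<rightarrow>\<^bsub>H\<^esub> q"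
      using sep' by auto
    ultimately show ?thesis using x(1) by blast
  qed
qed

section \<open>Deleting a color class\<close>

lemma delete_color_simps [simp]:
  "verts (delete_color G c i) = verts G"
  "arcs (delete_color G c i) = {e \<in> arcs G. c {tail G e, head G e} \<noteq> i}"
  "tail (delete_color G c i) = tail G"
  "head (delete_color G c i) = head G"
  by (simp_all add: delete_color_def)

lemma dominates_delete_color:
  "u \<rightarrow>\<^bsub>delete_color G c i\<^esub> v \<longleftrightarrow> u \<rightarrow>\<^bsub>G\<^esub> v \<and> c {u, v} \<noteq> i"
  by (auto simp: arcs_ends_conv)

lemma graph_delete_color:
  assumes "graph G"
  shows "graph (delete_color G c i)"
proof -
  interpret graph G by fact
  have "symmetric (delete_color G c i)"
    unfolding symmetric_def
    by (rule symI) (use graph_symmetric in \<open>auto simp: dominates_delete_color insert_commute\<close>)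
  then show ?thesis
    by unfold_locales
      (auto dest: no_loops intro: no_multi_arcs simp: arc_to_ends_def)
qed

lemma subgraph_delete_color:
  assumes "graph G"
  shows "subgraph (delete_color G c i) G"
proof -
  interpret G: graph G by fact
  interpret H: graph "delete_color G c i" using assms by (rule graph_delete_color)
  show ?thesis
    using G.wf_digraph H.wf_digraph by (auto simp: subgraph_def compatible_def)
qed

lemma colors_used_delete_color:
  "colors_used c (delete_color G c i) = colors_used c G - {i}"
  unfolding colors_used_def edge_set_def by (auto simp: dominates_delete_color)

text \<open>
  In a complete graph, a pair without an edge after the deletion must have had the deleted
  color, so a separation of what is left is a cut of that color.
\<close>

lemma color_cut_if_not_2_connected:
  assumes G: "complete_digraph n G" and "3 \<le> n"
    and "\<not> k_connected 2 (delete_color G c i)"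
  shows "\<exists>x\<in>verts G. \<exists>A. color_cut c i (verts G - {x}) A"
proof -
  have "card (verts G) = n" and adj: "u \<rightarrow>\<^bsub>G\<^esub> v \<longleftrightarrow> u \<in> verts G \<and> v \<in> verts G \<and> u \<noteq> v" for u v
    using G by (auto simp: complete_digraph_def)
  then obtain x A where x: "x \<in> verts G" and A: "A \<subset> verts G - {x}" "A \<noteq> {}"
      "\<forall>a\<in>A. \<forall>b\<in>verts G - {x} - A. \<not> a \<rightarrow>\<^bsub>delete_color G c i\<^esub> b"
    using not_2_connected_separation[of "delete_color G c i"] assms(2,3) by auto
  have "c {a, b} = i" if "a \<in> A" "b \<in> verts G - {x} - A" for a b
  proof -
    have "a \<rightarrow>\<^bsub>G\<^esub> b" using adj A(1) that by blast
    then show ?thesis using A(3) that by (auto simp: dominates_delete_color)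
  qed
  then show ?thesis using x A(1,2) unfolding color_cut_def by blast
qed

section \<open>Spanning 2-connected subgraphs in two colors\<close>

theorem lemma5p2:
  fixes n :: nat
    and G :: "('a, 'b) pre_digraph"
    and c :: "'a set \<Rightarrow> 'c"
  assumes "n \<ge> 7"
    and "complete_digraph n G"
    and "gallai_coloring 3 G c"
  shows "\<exists>H. subgraph H G \<and> graph H \<and> card (verts H) = n \<and>
           k_connected 2 H \<and> card (colors_used c H) \<le> 2"
proof (rule ccontr)
  assume neg: "\<not> ?thesis"
  let ?V = "verts G"
  have G: "graph G" and card: "card ?V = n"
    and adj: "\<And>u v. u \<rightarrow>\<^bsub>G\<^esub> v \<longleftrightarrow> u \<in> ?V \<and> v \<in> ?V \<and> u \<noteq> v"
    using assms(2) by (auto simp: complete_digraph_def)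
  have colors: "card (colors_used c G) = 3"
    and no_rainbow: "\<And>u v w. \<not> rainbow_triangle G c u v w"
    using assms(3) by (auto simp: gallai_coloring_def)
  have cut: "\<exists>x\<in>?V. \<exists>A. color_cut c i (?V - {x}) A" if "i \<in> colors_used c G" for i
  proof -
    have "card (colors_used c (delete_color G c i)) \<le> 2"
      using colors that by (simp add: colors_used_delete_color)
    then have "\<not> k_connected 2 (delete_color G c i)"
      using neg subgraph_delete_color[OF G, of c i] graph_delete_color[OF G, of c i] card
      by auto
    then show ?thesis
      using color_cut_if_not_2_connected[OF assms(2)] assms(1) by simp
  qed
  obtain i j k where "colors_used c G = {i, j, k}" and ne: "i \<noteq> j" "j \<noteq> k" "i \<noteq> k"
    using colors by (auto simp: card_3_iff)
  then obtain x y z A B C where V: "x \<in> ?V" "y \<in> ?V" "z \<in> ?V"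
    and cuts: "color_cut c i (?V - {x}) A" "color_cut c j (?V - {y}) B"
      "color_cut c k (?V - {z}) C"
    using cut[of i] cut[of j] cut[of k] by auto
  have "4 \<le> card ?V" using card assms(1) by simp
  then have "rainbow_triangle G c x y z"
    using three_color_cuts_rainbow[OF cuts ne V] V by (auto simp: rainbow_triangle_def adj)
  then show False using no_rainbow by blast
qed

end
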